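(* An FSA $\mathcal{S}$ is not strongly periodically detectable if and only if in its observer $\mathcal{S}_{obs}$ at least one of the two following conditions holds. (i) There is a reachable state $q\in 2^X$ in $\mathcal{S}_{obs}$ and $x\in q$ such that $|q|>1$ and there is a transition sequence $x\xrightarrow{s_1}x'\xrightarrow{s_2}x'$ in $\mathcal{S}$ for some $s_1\in(T_{uo})^*$, $s_2\in(T_{uo})^+$, $x'\in X$. (ii) There is a reachable transition cycle in $\mathcal{S}_{obs}$ such that no state in the cycle is a singleton.
   Context: The symbol $\subset$ denotes the (not necessarily proper) subset relation. For a finite alphabet $A$, $A^*$ and $A^\omega$ denote the sets of finite words (including the empty word $\epsilon$) and of infinite sequences over $A$, and $A^+=A^*\setminus\{\epsilon\}$. For $s\in A^*\cup A^\omega$, $s'\sqsubset s$ means that $s'\in A^*$ is a (not necessarily proper) prefix of $s$. $|s|$ is the length of a word $s$; $|S|$ is the cardinality of a set $S$, and $2^S$ its power set. A singleton is a set of cardinality $1$. A finite-state automaton (FSA) is a sextuple $\mathcal{S}=(X,T,X_0,\delta,\Sigma,\ell)$, where $X$ is a finite set of states, $T$ a finite set of events, $X_0\subset X$ a set of initial states, $\delta\subset X\times T\times X$ a transition relation, $\Sigma$ a finite set of outputs (labels), and $\ell:T\to\Sigma\cup\{\epsilon\}$ a labeling function, extended to $\ell:T^*\cup T^\omega\to\Sigma^*\cup\Sigma^\omega$ by $\ell(t_1t_2\dots)=\ell(t_1)\ell(t_2)\dots$, $\ell(\epsilon)=\epsilon$ (a sequence in $T^\omega$ may have a finite label sequence).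 $T_{uo}=\{t\in T:\ell(t)=\epsilon\}$ is the set of unobservable events. $\delta$ is extended to $\delta\subset X\times T^*\times X$ in the usual way; $x\xrightarrow{s}x'$ means $(x,s,x')\in\delta$. $L^\omega(\mathcal{S})=\{t_1t_2\dots\in T^\omega : \exists x_0\in X_0,\ \exists x_1,x_2,\dots\in X,\ x_0\xrightarrow{t_1}x_1\xrightarrow{t_2}\cdots\}$. For $\sigma\in\Sigma^*$, the current-state estimate is $\mathcal{M}(\mathcal{S},\sigma)=\{x\in X : \exists x_0\in X_0,\ \exists s\in T^*,\ \ell(s)=\sigma \text{ and } x_0\xrightarrow{s}x\}$. $\mathcal{S}$ is strongly periodically detectable if there exists a positive integer $k$ such that for each $s\in L^\omega(\mathcal{S})$ and each finite prefix $s'\sqsubset s$, there is $s''\in T^*$ such that $|\ell(s'')|<k$, $s's''\sqsubset s$, and $|\mathcal{M}(\mathcal{S},\ell(s's''))|=1$. The observer $\mathcal{S}_{obs}=(2^X\setminus\{\emptyset\},\Sigma,\mathcal{M}(\mathcal{S},\epsilon),\delta_{obs})$ is the deterministic automaton with unique initial state $\mathcal{M}(\mathcal{S},\epsilon)$ such that for all nonempty $X'\in 2^X$ and $\sigma\in\Sigma^*$, $\delta_{obs}(\mathcal{M}(\mathcal{S},\epsilon),\sigma)=X'$ if and only if $X'=\mathcal{M}(\mathcal{S},\sigma)$; that is, its transitions are $(\mathcal{M}(\mathcal{S},\tau),a,\mathcal{M}(\mathcal{S},\tau a))$ for $\tau\in\Sigma^*$, $a\in\Sigma$ with $\mathcal{M}(\mathcal{S},\tau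 a)\ne\emptyset$. In an automaton, a state is reachable if it is initial or can be reached from an initial state by a transition sequence. A transition cycle is a transition sequence of positive length from a state to itself; the states of the cycle are all states visited along it; it is reachable if its states are reachable. *)

theory Defs
  imports Main "HOL-Library.Stream"
begin

record ('q, 'e) automaton =
  states :: "'q set"
  events :: "'e set"
  init :: "'q set"
  trans :: "('q \<times> 'e \<times> 'q) set"

text \<open>
  A labeling function into \<open>\<Sigma> \<union> {\<epsilon>}\<close> is a partial function: \<^term>\<open>None\<close> stands for the
  empty word \<open>\<epsilon>\<close>.
\<close>

record ('q, 'e, 'o) fsa = "('q, 'e) automaton" +
  outputs :: "'o set"
  label :: "'e \<Rightarrow> 'o option"

locale finite_state_automaton =
  fixes S :: "('q, 'e, 'o) fsa"
  assumes finite_states: "finite (states S)"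
    and finite_events: "finite (events S)"
    and init_subset: "init S \<subseteq> states S"
    and trans_subset: "trans S \<subseteq> states S \<times> events S \<times> states S"
    and finite_outputs: "finite (outputs S)"
    and label_outputs: "\<And>t. t \<in> events S \<Longrightarrow> set_option (label S t) \<subseteq> outputs S"

text \<open>
  A transition sequence of length \<open>n\<close> is given by the list \<open>qs\<close> of the \<open>n + 1\<close> states it visits
  and the word \<open>w\<close> of length \<open>n\<close> it reads.
\<close>

definition transition_sequence ::
    "('q, 'e, 'm) automaton_scheme \<Rightarrow> 'q list \<Rightarrow> 'e list \<Rightarrow> bool" where
  "transition_sequence A qs w \<longleftrightarrow>
     length qs = Suc (length w) \<and> set qs \<subseteq> states A \<and>
     (\<forall>i < length w. (qs ! i, w ! i, qs ! Suc i) \<in> trans A)"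

definition steps :: "('q, 'e, 'm) automaton_scheme \<Rightarrow> 'q \<Rightarrow> 'e list \<Rightarrow> 'q \<Rightarrow> bool" where
  "steps A q w q' \<longleftrightarrow> (\<exists>qs. transition_sequence A qs w \<and> hd qs = q \<and> last qs = q')"

definition reachable :: "('q, 'e, 'm) automaton_scheme \<Rightarrow> 'q \<Rightarrow> bool" where
  "reachable A q \<longleftrightarrow> q \<in> init A \<or> (\<exists>q\<^sub>0 \<in> init A. \<exists>w. steps A q\<^sub>0 w q)"

definition transition_cycle ::
    "('q, 'e, 'm) automaton_scheme \<Rightarrow> 'q list \<Rightarrow> 'e list \<Rightarrow> bool" where
  "transition_cycle A qs w \<longleftrightarrow> transition_sequence A qs w \<and> w \<noteq> [] \<and> hd qs = last qs"

definition reachable_cycle ::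
    "('q, 'e, 'm) automaton_scheme \<Rightarrow> 'q list \<Rightarrow> 'e list \<Rightarrow> bool" where
  "reachable_cycle A qs w \<longleftrightarrow> transition_cycle A qs w \<and> (\<forall>q \<in> set qs. reachable A q)"

definition label_word :: "('q, 'e, 'o) fsa \<Rightarrow> 'e list \<Rightarrow> 'o list" where
  "label_word S w = List.map_filter (label S) w"

definition unobservable_events :: "('q, 'e, 'o) fsa \<Rightarrow> 'e set" where
  "unobservable_events S = {t \<in> events S. label S t = None}"

definition omega_language :: "('q, 'e, 'm) automaton_scheme \<Rightarrow> 'e stream set" where
  "omega_language A =
     {s \<in> streams (events A).
        \<exists>x :: nat \<Rightarrow> 'q. x 0 \<in> init A \<and> (\<forall>i. (x i, s !! i, x (Suc i)) \<in> trans A)}"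

definition stream_prefix :: "'e list \<Rightarrow> 'e stream \<Rightarrow> bool" where
  "stream_prefix u s \<longleftrightarrow> (\<exists>r. s = u @- r)"

definition state_estimate :: "('q, 'e, 'o) fsa \<Rightarrow> 'o list \<Rightarrow> 'q set" where
  "state_estimate S \<sigma> =
     {x \<in> states S. \<exists>x\<^sub>0 \<in> init S. \<exists>s \<in> lists (events S). label_word S s = \<sigma> \<and> steps S x\<^sub>0 s x}"

definition strongly_periodically_detectable :: "('q, 'e, 'o) fsa \<Rightarrow> bool" where
  "strongly_periodically_detectable S \<longleftrightarrow>
     (\<exists>k :: nat. k > 0 \<and>
        (\<forall>s \<in> omega_language S. \<forall>s'. stream_prefix s' s \<longrightarrow>
           (\<exists>s'' \<in> lists (events S).
              length (label_word S s'') < k \<and> stream_prefix (s' @ s'') s \<and>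
              card (state_estimate S (label_word S (s' @ s''))) = 1)))"

text \<open>
  If there are no initial states, the initial state of the observer is the empty set, which is not
  among its states; it then has no transitions.
\<close>

definition observer :: "('q, 'e, 'o) fsa \<Rightarrow> ('q set, 'o) automaton" where
  "observer S =
     \<lparr> states = Pow (states S) - {{}},
       events = outputs S,
       init = {state_estimate S []},
       trans = {(state_estimate S \<tau>, a, state_estimate S (\<tau> @ [a])) | \<tau> a.
                  \<tau> \<in> lists (outputs S) \<and> a \<in> outputs S \<and> state_estimate S (\<tau> @ [a]) \<noteq> {}} \<rparr>"

end

theory Submission
  imports Defs
begin

text \<open>
  Both conditions yield a lasso \<open>v u\<^sup>\<omega>\<close> in \<open>S\<close> along whose periodic part no estimate is a singleton:
  in (i) the loop \<open>u\<close> is unobservable; in (ii) every state of the nonempty finite estimate \<open>q\<close> at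
  which the observer cycle starts has a predecessor in \<open>q\<close> via a word labeled by that cycle, so these
  predecessors close up to a loop inside \<open>q\<close>. Conversely, let \<open>s = s' r\<close> violate detectability for
  a \<open>k\<close> exceeding the number of sets of states. If \<open>r\<close> has fewer than \<open>k\<close> labels, then it is
  eventually unobservable and a repeated state gives (i); otherwise the first \<open>k\<close> estimates after
  \<open>s'\<close> contain a repetition, which gives (ii).
\<close>

section \<open>Transition sequences and runs\<close>

lemma transition_sequence_Nil:
  "transition_sequence A qs [] \<longleftrightarrow> (\<exists>q \<in> states A. qs = [q])"
  by (auto simp: transition_sequence_def length_Suc_conv)

lemma transition_sequence_Cons:
  "transition_sequence A qs (e # w) \<longleftrightarrow>
     (\<exists>q qs'. qs = q # qs' \<and> q \<in> states A \<and> (q, e, hd qs') \<in> trans A \<and> transition_sequence A qs' w)"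
proof (cases qs)
  case (Cons q qs')
  then show ?thesis
    by (cases qs') (auto simp: transition_sequence_def All_less_Suc2)
qed (auto simp: transition_sequence_def)

lemma steps_Nil: "steps A q [] q' \<longleftrightarrow> q = q' \<and> q \<in> states A"
  by (auto simp: steps_def transition_sequence_Nil)

lemma steps_Cons:
  "steps A q (e # w) q' \<longleftrightarrow> q \<in> states A \<and> (\<exists>r. (q, e, r) \<in> trans A \<and> steps A r w q')"
proof -
  have [simp]: "transition_sequence A qs w \<Longrightarrow> qs \<noteq> []" for qs
    by (auto simp: transition_sequence_def)
  show ?thesis
  proof
    assume "steps A q (e # w) q'"
    then show "q \<in> states A \<and> (\<exists>r. (q, e, r) \<in> trans A \<and> steps A r w q')"
      by (fastforce simp: steps_def transition_sequence_Cons)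
  next
    assume "q \<in> states A \<and> (\<exists>r. (q, e, r) \<in> trans A \<and> steps A r w q')"
    then obtain qs where "q \<in> states A" "(q, e, hd qs) \<in> trans A"
      "transition_sequence A qs w" "last qs = q'"
      by (auto simp: steps_def)
    then show "steps A q (e # w) q'"
      unfolding steps_def transition_sequence_Cons by (intro exI[of _ "q # qs"]) auto
  qed
qed

lemma steps_states:
  assumes "steps A q w q'"
  shows "q \<in> states A" "q' \<in> states A"
  using assms by (induction w arbitrary: q) (auto simp: steps_Nil steps_Cons)

lemma steps_append:
  "steps A q (u @ v) q' \<longleftrightarrow> (\<exists>p. steps A q u p \<and> steps A p v q')"
  by (induction u arbitrary: q) (auto simp: steps_Nil steps_Cons dest: steps_states)

text \<open>The state condition of \<open>omega_language\<close> with an arbitrary start, so that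
  runs can be composed from pieces.\<close>

definition run :: "('q, 'e, 'm) automaton_scheme \<Rightarrow> 'q \<Rightarrow> 'e stream \<Rightarrow> bool" where
  "run A q s \<longleftrightarrow> (\<exists>x. x 0 = q \<and> (\<forall>i. (x i, s !! i, x (Suc i)) \<in> trans A))"

lemma run_Stream:
  assumes "(q, e, q') \<in> trans A" "run A q' s"
  shows "run A q (e ## s)"
proof -
  obtain x where x: "x 0 = q'" "\<And>i. (x i, s !! i, x (Suc i)) \<in> trans A"
    using assms(2) by (auto simp: run_def)
  have "(case_nat q x i, (e ## s) !! i, case_nat q x (Suc i)) \<in> trans A" for i
    using assms(1) x by (cases i) auto
  then show ?thesis
    unfolding run_def by (intro exI[of _ "case_nat q x"]) auto
qed

lemma run_shift:
  assumes "steps A q u q'" "run A q' s"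
  shows "run A q (u @- s)"
  using assms(1)
  by (induction u arbitrary: q) (auto simp: steps_Nil steps_Cons assms(2) intro: run_Stream)

text \<open>Dropping \<open>i\<close> letters of a periodic stream leaves the periodic stream of a
  rotated word, whose head is the letter sought.\<close>

lemma snth_cycle:
  assumes "u \<noteq> []"
  shows "cycle u !! i = u ! (i mod length u)"
proof -
  have "cycle u !! i = shd (cycle (rotate (i mod length u) u))"
    using sdrop_cycle[OF assms, of i] by (metis sdrop_simps(1))
  also have "\<dots> = hd (rotate (i mod length u) u)"
    using assms by (metis cycle.sel(1) rotate_is_Nil_conv)
  also have "\<dots> = u ! (i mod length u)"
    using assms by (simp add: hd_rotate_conv_nth)
  finally show ?thesis .
qed

lemma run_cycle:
  assumes "steps A q u q" "u \<noteq> []"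
  shows "run A q (cycle u)"
proof -
  obtain qs where len: "length qs = Suc (length u)"
    and tr: "\<And>i. i < length u \<Longrightarrow> (qs ! i, u ! i, qs ! Suc i) \<in> trans A"
    and hd: "hd qs = q" and last: "last qs = q"
    using assms(1) by (auto simp: steps_def transition_sequence_def)
  have ends: "qs ! 0 = q" "qs ! length u = q"
    using len hd last hd_conv_nth[of qs] last_conv_nth[of qs] by (cases "qs = []"; simp)+
  define x where "x i = qs ! (i mod length u)" for i
  have "(x i, cycle u !! i, x (Suc i)) \<in> trans A" for i
  proof -
    have "i mod length u < length u"
      using assms(2) by simp
    \<comment> \<open>If \<open>Suc i mod length u\<close> wraps to 0, the right-hand index is
      \<open>length u\<close>; both positions of \<open>qs\<close> hold \<open>q\<close>.\<close>
    moreover have "x (Suc i) = qs ! Suc (i mod length u)"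
      using ends by (simp add: x_def mod_Suc)
    ultimately show ?thesis
      using tr[of "i mod length u"] by (simp add: x_def snth_cycle[OF assms(2)])
  qed
  moreover have "x 0 = q"
    using ends by (simp add: x_def)
  ultimately show ?thesis
    by (auto simp: run_def)
qed

section \<open>Prefixes of periodic streams\<close>

lemma cycle_eq_shift_replicate:
  assumes "u \<noteq> []"
  shows "cycle u = concat (replicate n u) @- cycle u"
  by (induction n) (use cycle_decomp[OF assms] in auto)

lemma shift_eq_shiftD:
  assumes "p @- r = l @- s" "length p \<le> length l"
  shows "\<exists>t. p @ t = l"
  using assms
proof (induction p arbitrary: l)
  case (Cons a p)
  then show ?case
    by (cases l) auto
qed auto

text \<open>Replaces the periodic stream by finite powers of \<open>u\<close>, which admit
  induction. As \<open>u\<close> is nonempty, \<open>length p\<close> copies are long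
  enough.\<close>

lemma stream_prefix_cycle:
  assumes "stream_prefix p (cycle u)" "u \<noteq> []"
  shows "\<exists>t n. p @ t = concat (replicate n u)"
proof -
  have "length p \<le> length (concat (replicate (length p) u))"
    using assms(2) by (induction "length p") (auto simp: length_concat sum_list_replicate Suc_le_eq)
  then show ?thesis
    using assms cycle_eq_shift_replicate shift_eq_shiftD unfolding stream_prefix_def by metis
qed

section \<open>Labels and state estimates\<close>

lemma label_word_Nil [simp]: "label_word S [] = []"
  by (simp add: label_word_def map_filter_def)

lemma label_word_append [simp]: "label_word S (u @ v) = label_word S u @ label_word S v"
  by (simp add: label_word_def map_filter_def)

lemma label_word_Cons:
  "label_word S (e # w) = (case label S e of None \<Rightarrow> [] | Some a \<Rightarrow> [a]) @ label_word S w"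
  by (auto simp: label_word_def map_filter_def split: option.split)

lemma label_word_concat_replicate:
  "label_word S (concat (replicate n u)) = concat (replicate n (label_word S u))"
  by (induction n) auto

lemma label_word_eq_Nil_iff:
  "label_word S w = [] \<longleftrightarrow> (\<forall>t \<in> set w. label S t = None)"
  by (induction w) (auto simp: label_word_Cons split: option.split)

text \<open>Read events until the labels of \<sigma> are used up. Unobservable events make the cut
  ambiguous; the induction takes the shortest \<open>u\<close>.\<close>

lemma label_word_eq_appendE:
  assumes "label_word S s = \<sigma> @ \<tau>"
  obtains u v where "s = u @ v" "label_word S u = \<sigma>" "label_word S v = \<tau>"
  using assms
proof (induction s arbitrary: \<sigma> thesis)
  case Nil
  then show ?case by auto
next
  case (Cons e s)
  show ?case
  proof (cases "\<sigma> = []")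
    case True
    then show ?thesis
      using Cons.prems(1)[of "[]" "e # s"] Cons.prems(2) by auto
  next
    case False
    define c where "c = (case label S e of None \<Rightarrow> [] | Some a \<Rightarrow> [a])"
    \<comment> \<open>\<open>c\<close> has at most one letter and \<sigma> at least one, so
      \<open>c\<close> is a prefix of \<sigma>.\<close>
    obtain \<sigma>' where \<sigma>': "\<sigma> = c @ \<sigma>'" "label_word S s = \<sigma>' @ \<tau>"
      using Cons.prems(2) False
      by (cases \<sigma>) (auto simp: c_def label_word_Cons split: option.splits)
    obtain u v where "s = u @ v" "label_word S u = \<sigma>'" "label_word S v = \<tau>"
      using Cons.IH[OF _ \<sigma>'(2)] by blast
    then show ?thesis
      using Cons.prems(1)[of "e # u" v] \<sigma>' by (simp add: label_word_Cons c_def)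
  qed
qed

context finite_state_automaton
begin

lemma steps_lists_events: "steps S q w q' \<Longrightarrow> w \<in> lists (events S)"
  using trans_subset by (induction w arbitrary: q) (auto simp: steps_Cons)

lemma state_estimate_iff:
  "x \<in> state_estimate S \<sigma> \<longleftrightarrow> (\<exists>x\<^sub>0 \<in> init S. \<exists>s. label_word S s = \<sigma> \<and> steps S x\<^sub>0 s x)"
  unfolding state_estimate_def mem_Collect_eq using steps_states(2)[of S] steps_lists_events by blast

lemma state_estimate_subset: "state_estimate S \<sigma> \<subseteq> states S"
  by (auto simp: state_estimate_def)

text \<open>A path is cut where its label word is cut. The right-hand side depends on \<sigma> only
  through its estimate, which makes the observer deterministic.\<close>

lemma state_estimate_append:
  "state_estimate S (\<sigma> @ \<tau>) =
     {x. \<exists>y \<in> state_estimate S \<sigma>. \<exists>u. label_word S u = \<tau> \<and> steps S y u x}"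
    (is "?L = ?R")
proof (intro equalityI subsetI)
  fix x
  assume "x \<in> ?L"
  then obtain x\<^sub>0 s where s: "label_word S s = \<sigma> @ \<tau>" "x\<^sub>0 \<in> init S" "steps S x\<^sub>0 s x"
    by (auto simp: state_estimate_iff)
  from s(1) obtain u v where "s = u @ v" "label_word S u = \<sigma>" "label_word S v = \<tau>"
    by (rule label_word_eq_appendE)
  then show "x \<in> ?R"
    using s(2,3) by (fastforce simp: steps_append state_estimate_iff)
next
  fix x
  assume "x \<in> ?R"
  then obtain x\<^sub>0 s y u where "x\<^sub>0 \<in> init S" "label_word S (s @ u) = \<sigma> @ \<tau>"
    "steps S x\<^sub>0 s y" "steps S y u x"
    by (auto simp: state_estimate_iff)
  moreover from this have "steps S x\<^sub>0 (s @ u) x"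
    by (auto simp: steps_append)
  ultimately show "x \<in> ?L"
    unfolding state_estimate_iff by blast
qed

lemma state_estimate_append_cong:
  "state_estimate S \<sigma> = state_estimate S \<sigma>' \<Longrightarrow>
     state_estimate S (\<sigma> @ \<tau>) = state_estimate S (\<sigma>' @ \<tau>)"
  by (simp add: state_estimate_append)

lemma state_estimate_append_nonempty:
  "state_estimate S (\<sigma> @ \<tau>) \<noteq> {} \<Longrightarrow> state_estimate S \<sigma> \<noteq> {}"
  by (auto simp: state_estimate_append)

lemma state_estimate_take_nonempty:
  "state_estimate S (\<sigma> @ \<tau>) \<noteq> {} \<Longrightarrow> state_estimate S (\<sigma> @ take i \<tau>) \<noteq> {}"
  using state_estimate_append_nonempty[of "\<sigma> @ take i \<tau>" "drop i \<tau>"] by simp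

lemma label_word_outputs: "w \<in> lists (events S) \<Longrightarrow> label_word S w \<in> lists (outputs S)"
  using label_outputs by (induction w) (fastforce simp: label_word_Cons split: option.split)+

text \<open>Such a word labels a path of \<open>S\<close>; this discharges the alphabet conditions
  on observer transitions.\<close>

lemma state_estimate_nonempty_outputs:
  "state_estimate S \<sigma> \<noteq> {} \<Longrightarrow> \<sigma> \<in> lists (outputs S)"
  using steps_lists_events label_word_outputs state_estimate_iff by (metis all_not_in_conv)

text \<open>Finiteness of \<open>states S\<close> matters: \<open>card\<close> of an infinite set
  would be 0.\<close>

lemma card_state_estimate_gt_1:
  "state_estimate S \<sigma> \<noteq> {} \<Longrightarrow> card (state_estimate S \<sigma>) \<noteq> 1 \<Longrightarrow> card (state_estimate S \<sigma>) > 1"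
  using finite_subset[OF state_estimate_subset finite_states] card_0_eq nat_neq_iff less_one by metis

section \<open>The observer\<close>

text \<open>A transition presents its source as the estimate of some \<tau>, perhaps other than
  \<open>\<sigma> @ take i w\<close>; equal estimates stay equal after the next label.\<close>

lemma observer_transition_sequence_nth:
  assumes "transition_sequence (observer S) qs w" "hd qs = state_estimate S \<sigma>" "i \<le> length w"
  shows "qs ! i = state_estimate S (\<sigma> @ take i w)"
  using assms(3)
proof (induction i)
  case 0
  then show ?case
    using assms by (cases qs) (auto simp: transition_sequence_def)
next
  case (Suc i)
  have "(qs ! i, w ! i, qs ! Suc i) \<in> trans (observer S)"
    using assms(1) Suc.prems by (auto simp: transition_sequence_def)
  then obtain \<tau> where "qs ! i = state_estimate S \<tau>" "qs ! Suc i = state_estimate S (\<tau> @ [w ! i])"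
    by (auto simp: observer_def)
  then show ?case
    using Suc state_estimate_append_cong[of \<tau> "\<sigma> @ take i w" "[w ! i]"]
    by (simp add: take_Suc_conv_app_nth)
qed

text \<open>Estimates of prefixes of a word with nonempty estimate are nonempty, so every
  intermediate set is a state of the observer.\<close>

lemma observer_transition_sequence:
  assumes "state_estimate S (\<sigma> @ w) \<noteq> {}"
  shows "transition_sequence (observer S)
    (map (\<lambda>i. state_estimate S (\<sigma> @ take i w)) [0..<Suc (length w)]) w"
proof -
  define f where "f i = state_estimate S (\<sigma> @ take i w)" for i
  have ne: "f i \<noteq> {}" for i
    unfolding f_def using assms by (rule state_estimate_take_nonempty)
  have "(f i, w ! i, f (Suc i)) \<in> trans (observer S)" if "i < length w" for i
  proof -
    have Suc: "f (Suc i) = state_estimate S ((\<sigma> @ take i w) @ [w ! i])"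
      using that by (simp add: f_def take_Suc_conv_app_nth)
    then have "(\<sigma> @ take i w) @ [w ! i] \<in> lists (outputs S)"
      using ne[of "Suc i"] state_estimate_nonempty_outputs by metis
    then show ?thesis
      unfolding observer_def automaton.simps mem_Collect_eq
      by (intro exI[of _ "\<sigma> @ take i w"] exI[of _ "w ! i"])
        (use Suc ne[of "Suc i"] in \<open>auto simp: f_def\<close>)
  qed
  moreover have "f i \<in> states (observer S)" for i
    using ne[of i] state_estimate_subset by (auto simp: observer_def f_def)
  ultimately show ?thesis
    unfolding f_def[symmetric] transition_sequence_def
    by (auto simp del: upt_Suc)
qed

lemma reachable_observerD:
  assumes "reachable (observer S) q"
  obtains \<sigma> where "q = state_estimate S \<sigma>"
proof -
  \<comment> \<open>An empty initial estimate is not a state of the observer, so not even the empty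
    transition sequence reaches it; hence the separate case.\<close>
  consider "q = state_estimate S []" | w where "steps (observer S) (state_estimate S []) w q"
    using assms by (auto simp: reachable_def observer_def)
  then show thesis
  proof cases
    case 2
    then obtain qs where qs: "transition_sequence (observer S) qs w" "hd qs = state_estimate S []"
      "last qs = q"
      by (auto simp: steps_def)
    then have "q = qs ! length w"
      by (cases "qs = []") (auto simp: transition_sequence_def last_conv_nth)
    then show thesis
      using that observer_transition_sequence_nth[OF qs(1,2)] by simp
  qed (rule that)
qed

lemma reachable_observerI:
  assumes "state_estimate S \<sigma> \<noteq> {}"
  shows "reachable (observer S) (state_estimate S \<sigma>)"
proof -
  have "steps (observer S) (state_estimate S []) \<sigma> (state_estimate S \<sigma>)"
    unfolding steps_def
    using observer_transition_sequence[of "[]" \<sigma>] assms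
    by (intro exI[of _ "map (\<lambda>i. state_estimate S ([] @ take i \<sigma>)) [0..<Suc (length \<sigma>)]"])
      (auto simp: hd_map hd_upt last_map simp del: upt_Suc)
  then show ?thesis
    by (auto simp: reachable_def observer_def)
qed

section \<open>Lassos violate detectability\<close>

text \<open>Take \<open>v\<close> as the prefix of the stream \<open>v @- cycle u\<close>. For any
  \<open>k\<close>, the continuation promised by detectability would be a prefix of a power of
  \<open>u\<close>, where singletons are excluded.\<close>

lemma lasso_not_detectable:
  assumes x\<^sub>0: "x\<^sub>0 \<in> init S" and v: "steps S x\<^sub>0 v y" and u: "steps S y u y" "u \<noteq> []"
    and no_singleton: "\<And>p t n. p @ t = concat (replicate n u) \<Longrightarrow>
      card (state_estimate S (label_word S (v @ p))) \<noteq> 1"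
  shows "\<not> strongly_periodically_detectable S"
proof
  assume "strongly_periodically_detectable S"
  then obtain k where k: "\<And>s s'. s \<in> omega_language S \<Longrightarrow> stream_prefix s' s \<Longrightarrow>
      \<exists>s'' \<in> lists (events S). length (label_word S s'') < k \<and> stream_prefix (s' @ s'') s \<and>
        card (state_estimate S (label_word S (s' @ s''))) = 1"
    unfolding strongly_periodically_detectable_def by blast
  define s where "s = v @- cycle u"
  obtain x where x: "x 0 = x\<^sub>0" "\<And>i. (x i, s !! i, x (Suc i)) \<in> trans S"
    using run_shift[OF v run_cycle[OF u]] by (auto simp: run_def s_def)
  then have "s \<in> streams (events S)"
    using trans_subset by (fastforce simp: streams_iff_snth)
  then have "s \<in> omega_language S"
    using x x\<^sub>0 by (auto simp: omega_language_def)
  moreover have "stream_prefix v s"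
    by (auto simp: stream_prefix_def s_def)
  ultimately obtain p where p: "stream_prefix (v @ p) s"
    "card (state_estimate S (label_word S (v @ p))) = 1"
    using k by blast
  have "stream_prefix p (cycle u)"
    using p(1) by (auto simp: stream_prefix_def s_def)
  then show False
    using stream_prefix_cycle[OF _ u(2)] no_singleton p(2) by blast
qed

text \<open>After reaching \<open>x\<close>, the lasso emits no further label, so the estimate
  remains \<open>q\<close>.\<close>

lemma unobservable_cycle_not_detectable:
  assumes "reachable (observer S) q" "x \<in> q" "card q > 1"
    and s\<^sub>1: "s\<^sub>1 \<in> lists (unobservable_events S)" "steps S x s\<^sub>1 x'"
    and s\<^sub>2: "s\<^sub>2 \<in> lists (unobservable_events S)" "s\<^sub>2 \<noteq> []" "steps S x' s\<^sub>2 x'"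
  shows "\<not> strongly_periodically_detectable S"
proof -
  obtain \<sigma> where \<sigma>: "q = state_estimate S \<sigma>"
    using assms(1) by (rule reachable_observerD)
  then obtain x\<^sub>0 v where v: "x\<^sub>0 \<in> init S" "label_word S v = \<sigma>" "steps S x\<^sub>0 v x"
    using assms(2) by (auto simp: state_estimate_iff)
  show ?thesis
  proof (rule lasso_not_detectable)
    show "steps S x\<^sub>0 (v @ s\<^sub>1) x'"
      using v s\<^sub>1 by (auto simp: steps_append)
    fix p t n
    assume "p @ t = concat (replicate n s\<^sub>2)"
    then have "set p \<subseteq> set s\<^sub>2"
      by (metis Un_subset_iff set_append set_concat set_replicate_conv_if SUP_le_iff
        empty_iff singletonD subset_refl)
    then have "label_word S p = []" "label_word S s\<^sub>1 = []"
      using s\<^sub>1(1) s\<^sub>2(1) by (auto simp: label_word_eq_Nil_iff unobservable_events_def)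
    then show "card (state_estimate S (label_word S ((v @ s\<^sub>1) @ p))) \<noteq> 1"
      using v assms(3) \<sigma> by simp
  qed (use v s\<^sub>2 in auto)
qed

text \<open>Following \<open>w\<close> forwards may run into dead ends, but every state of the
  estimate has a predecessor in it along a path labeled \<open>w\<close>. A finite acyclic relation
  would be well-founded and leave some state without predecessor, so there is a cycle;
  \<open>n\<close> counts its edges.\<close>

lemma label_loop_in_estimate:
  assumes "state_estimate S \<sigma> \<noteq> {}" "state_estimate S (\<sigma> @ w) = state_estimate S \<sigma>"
  obtains z u n where "z \<in> state_estimate S \<sigma>" "steps S z u z" "n > 0"
    "label_word S u = concat (replicate n w)"
proof -
  define Q where "Q = state_estimate S \<sigma>"
  define R where "R = {(x, y). x \<in> Q \<and> y \<in> Q \<and> (\<exists>u. label_word S u = w \<and> steps S x u y)}"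
  have "finite Q"
    unfolding Q_def by (rule finite_subset[OF state_estimate_subset finite_states])
  moreover have "R \<subseteq> Q \<times> Q"
    by (auto simp: R_def)
  ultimately have "finite R"
    by (meson finite_SigmaI finite_subset)
  have pred: "\<exists>x. (x, y) \<in> R" if "y \<in> Q" for y
    using that assms(2) state_estimate_append[of \<sigma> w] by (fastforce simp: R_def Q_def)
  have "\<not> wf R"
  proof
    assume "wf R"
    moreover obtain y where "y \<in> Q"
      using assms(1) by (auto simp: Q_def)
    ultimately obtain z where "z \<in> Q" "\<And>y. (y, z) \<in> R \<Longrightarrow> y \<notin> Q"
      using wfE_min by metis
    then show False
      using pred \<open>R \<subseteq> Q \<times> Q\<close> by blast
  qed
  then obtain z where z: "(z, z) \<in> R\<^sup>+"
    using finite_acyclic_wf[OF \<open>finite R\<close>] by (auto simp: acyclic_def)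
  have "\<exists>u n. n > 0 \<and> steps S x u y \<and> label_word S u = concat (replicate n w)"
    if "(x, y) \<in> R\<^sup>+" for x y
    using that
  proof (induction rule: trancl_induct)
    case (base y)
    then obtain u where "steps S x u y" "label_word S u = w"
      by (auto simp: R_def)
    then show ?case
      by (intro exI[of _ u] exI[of _ 1]) auto
  next
    case (step y y')
    then obtain u n u' where "steps S x u y" "label_word S u = concat (replicate n w)"
      "steps S y u' y'" "label_word S u' = w"
      by (auto simp: R_def)
    then show ?case
      by (intro exI[of _ "u @ u'"] exI[of _ "Suc n"])
        (auto simp: steps_append simp flip: replicate_append_same)
  qed
  moreover have "z \<in> state_estimate S \<sigma>"
    using z \<open>R \<subseteq> Q \<times> Q\<close> by (metis Q_def SigmaD1 subsetD tranclD)
  ultimately show thesis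
    using that z by blast
qed

text \<open>Peel off one lap at a time. A prefix ending in the first lap is found by its length;
  otherwise the lap returns to \<open>hd qs\<close> and the induction hypothesis applies to
  \<open>\<sigma> @ w\<close>, which is why \<sigma> is generalized.\<close>

lemma observer_cycle_prefix_mem:
  assumes "transition_sequence (observer S) qs w" "hd qs = last qs"
    and "hd qs = state_estimate S \<sigma>" "a @ b = concat (replicate n w)"
  shows "state_estimate S (\<sigma> @ a) \<in> set qs"
  using assms(3,4)
proof (induction n arbitrary: \<sigma> a)
  have len: "length qs = Suc (length w)"
    using assms(1) by (simp add: transition_sequence_def)
  {
    case 0
    then show ?case
      using len by (cases qs) auto
  next
    case (Suc n)
    note nth = observer_transition_sequence_nth[OF assms(1) Suc.prems(1)]
    show ?case
    proof (cases "length a \<le> length w")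
      case True
      then have "a = take (length a) w"
        using Suc.prems(2) by (auto simp: append_eq_append_conv_if split: if_splits)
      then have "state_estimate S (\<sigma> @ a) = qs ! length a"
        using nth[OF True] by simp
      then show ?thesis
        using True len by simp
    next
      case False
      then obtain a' where a': "a = w @ a'" "a' @ b = concat (replicate n w)"
        using Suc.prems(2) by (auto simp: append_eq_append_conv2)
      have "hd qs = state_estimate S (\<sigma> @ w)"
        using nth[of "length w"] assms(2) len by (cases "qs = []") (auto simp: last_conv_nth)
      then show ?thesis
        using Suc.IH a' by fastforce
    qed
  }
qed

text \<open>One turn of the loop \<open>u\<close> in \<open>S\<close> makes \<open>n\<close> laps of
  the observer cycle, so every estimate along the periodic part lies on that cycle.\<close>

lemma observer_cycle_not_detectable:
  assumes "reachable_cycle (observer S) qs w" "\<forall>q \<in> set qs. card q \<noteq> 1"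
  shows "\<not> strongly_periodically_detectable S"
proof -
  have seq: "transition_sequence (observer S) qs w" and closed: "hd qs = last qs" and "w \<noteq> []"
    and reach: "\<And>q. q \<in> set qs \<Longrightarrow> reachable (observer S) q"
    using assms(1) by (auto simp: reachable_cycle_def transition_cycle_def)
  have len: "length qs = Suc (length w)"
    and "set qs \<subseteq> states (observer S)"
    using seq by (auto simp: transition_sequence_def)
  moreover from len have "qs \<noteq> []"
    by auto
  ultimately have ne: "hd qs \<noteq> {}"
    by (auto simp: observer_def dest: hd_in_set)
  obtain \<sigma> where \<sigma>: "hd qs = state_estimate S \<sigma>"
    using reach[OF hd_in_set[OF \<open>qs \<noteq> []\<close>]] by (rule reachable_observerD)
  have "state_estimate S (\<sigma> @ w) = state_estimate S \<sigma>"
    using observer_transition_sequence_nth[OF seq \<sigma>, of "length w"] \<sigma> closed len \<open>qs \<noteq> []\<close>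
    by (simp add: last_conv_nth)
  then obtain z u n where z: "z \<in> state_estimate S \<sigma>" "steps S z u z" "n > 0"
    "label_word S u = concat (replicate n w)"
    using label_loop_in_estimate ne \<sigma> by metis
  then obtain x\<^sub>0 v where v: "x\<^sub>0 \<in> init S" "label_word S v = \<sigma>" "steps S x\<^sub>0 v z"
    by (auto simp: state_estimate_iff)
  show ?thesis
  proof (rule lasso_not_detectable)
    \<comment> \<open>Since \<open>n > 0\<close> and \<open>w\<close> is nonempty, \<open>u\<close>
      has a nonempty label.\<close>
    show "u \<noteq> []"
      using z \<open>w \<noteq> []\<close> by (cases n) auto
    fix p t m
    assume "p @ t = concat (replicate m u)"
    then have "label_word S p @ label_word S t = concat (replicate m (label_word S u))"
      using label_word_append label_word_concat_replicate by metis
    also have "\<dots> = concat (replicate (m * n) w)"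
      unfolding z by (induction m) (auto simp: replicate_add)
    finally have "state_estimate S (\<sigma> @ label_word S p) \<in> set qs"
      by (rule observer_cycle_prefix_mem[OF seq closed \<sigma>])
    then show "card (state_estimate S (label_word S (v @ p))) \<noteq> 1"
      using assms(2) v by simp
  qed (use v z in auto)
qed

section \<open>Undetectable sequences\<close>

lemma run_steps:
  assumes "\<And>i. (x i, s !! i, x (Suc i)) \<in> trans S"
  shows "steps S (x i) (stake n (sdrop i s)) (x (i + n))"
proof (induction n arbitrary: i)
  case 0
  then show ?case
    using trans_subset assms[of i] by (auto simp: steps_Nil)
next
  case (Suc n)
  then show ?case
    using trans_subset assms[of i] Suc[of "Suc i"] by (auto simp: steps_Cons)
qed

text \<open>Infinitely many positions from \<open>N\<close> on share finitely many states; the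
  segment between two visits to one state is the loop.\<close>

lemma unobservable_tail_cycle:
  assumes x: "\<And>i. (x i, s !! i, x (Suc i)) \<in> trans S"
    and unobs: "\<And>i. i \<ge> N \<Longrightarrow> label S (s !! i) = None"
  obtains i w where "i \<ge> N" "w \<in> lists (unobservable_events S) - {[]}" "steps S (x i) w (x i)"
proof -
  have "x ` {N..} \<subseteq> states S"
    using x trans_subset by blast
  then have "\<not> inj_on x {N..}"
    using finite_states infinite_Ici finite_imageD finite_subset by metis
  then obtain i j where ij: "N \<le> i" "i < j" "x i = x j"
    unfolding inj_on_def by (metis atLeast_iff linorder_neqE_nat)
  define w where "w = stake (j - i) (sdrop i s)"
  have "steps S (x i) w (x i)"
    using run_steps[OF x, of i "j - i"] ij by (simp add: w_def)
  moreover have "label S t = None" if "t \<in> set w" for t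
    using that unobs ij by (auto simp: w_def in_set_conv_nth sdrop_snth)
  ultimately show thesis
    using that[of i w] steps_lists_events[of "x i" w] ij
    by (auto simp: unobservable_events_def w_def)
qed

text \<open>Pigeonhole: the prefixes of lengths 0 to \<open>card (Pow (states S))\<close> outnumber
  the subsets of \<open>states S\<close>, so two have the same estimate and the segment between them
  closes up.\<close>

lemma observer_cycleI:
  assumes ne: "state_estimate S (\<sigma> @ w) \<noteq> {}" and len: "card (Pow (states S)) \<le> length w"
    and no_singleton: "\<And>i. i \<le> card (Pow (states S)) \<Longrightarrow> card (state_estimate S (\<sigma> @ take i w)) \<noteq> 1"
  obtains qs w' where "reachable_cycle (observer S) qs w'" "\<forall>q \<in> set qs. card q \<noteq> 1"
proof -
  define K where "K = card (Pow (states S))"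
  define f where "f i = state_estimate S (\<sigma> @ take i w)" for i
  have "card (f ` {..K}) \<le> K"
    unfolding K_def f_def using finite_states state_estimate_subset by (intro card_mono) auto
  then have "\<not> inj_on f {..K}"
    using card_image by fastforce
  then obtain i j where ij: "i < j" "j \<le> K" "f i = f j"
    unfolding inj_on_def by (metis atMost_iff linorder_neqE_nat)
  define w' where "w' = take (j - i) (drop i w)"
  define qs where "qs = map (\<lambda>l. state_estimate S ((\<sigma> @ take i w) @ take l w')) [0..<Suc (length w')]"
  have w': "length w' = j - i"
    using ij len by (simp add: w'_def K_def)
  have take_w': "(\<sigma> @ take i w) @ take l w' = \<sigma> @ take (i + l) w" if "l \<le> j - i" for l
    using that by (simp add: w'_def take_add min_absorb1)
  have "state_estimate S ((\<sigma> @ take i w) @ w') \<noteq> {}"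
    using take_w'[of "j - i"] w' state_estimate_take_nonempty[OF ne] by simp
  then have "transition_sequence (observer S) qs w'"
    unfolding qs_def by (rule observer_transition_sequence)
  \<comment> \<open>Re-indexed from \<open>i\<close>, the visited states are \<open>f i\<close> to
    \<open>f j\<close>, whose ends agree.\<close>
  moreover have qs: "qs = map f [i..<Suc j]"
    using ij w' take_w' by (auto intro!: nth_equalityI simp: qs_def f_def simp del: upt_Suc)
  moreover have "hd qs = last qs"
    using ij by (simp add: qs hd_map last_map del: upt_Suc)
  moreover have "reachable (observer S) q" if "q \<in> set qs" for q
    using that state_estimate_take_nonempty[OF ne] by (auto simp: qs f_def intro: reachable_observerI)
  moreover have "\<forall>q \<in> set qs. card q \<noteq> 1"
    using ij no_singleton by (auto simp: qs f_def K_def)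
  moreover have "w' \<noteq> []"
    using ij w' by auto
  ultimately show thesis
    using that unfolding reachable_cycle_def transition_cycle_def by blast
qed

text \<open>Failure for the bound \<open>Suc K\<close> keeps estimates from being singletons while
  at most \<open>K\<close> labels follow \<open>s'\<close>. A tail that never reaches
  \<open>K\<close> labels is eventually silent; one that does supplies the \<open>K + 1\<close>
  estimates for \<open>observer_cycleI\<close>.\<close>

lemma not_detectable_cases:
  assumes "\<not> strongly_periodically_detectable S"
  obtains (unobservable) q x w where "reachable (observer S) q" "x \<in> q" "card q > 1"
      "w \<in> lists (unobservable_events S) - {[]}" "steps S x w x"
    | (observer) qs w where "reachable_cycle (observer S) qs w" "\<forall>q \<in> set qs. card q \<noteq> 1"
proof -
  define K where "K = card (Pow (states S))"
  obtain s s' where s: "s \<in> omega_language S" "stream_prefix s' s"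
    and bad: "\<And>s''. s'' \<in> lists (events S) \<Longrightarrow> length (label_word S s'') < Suc K \<Longrightarrow>
      stream_prefix (s' @ s'') s \<Longrightarrow> card (state_estimate S (label_word S (s' @ s''))) \<noteq> 1"
    using assms unfolding strongly_periodically_detectable_def by (metis zero_less_Suc)
  obtain r where r: "s = s' @- r"
    using s(2) by (auto simp: stream_prefix_def)
  obtain x where x0: "x 0 \<in> init S" and x: "\<And>i. (x i, s !! i, x (Suc i)) \<in> trans S"
    and ev: "s \<in> streams (events S)"
    using s(1) by (auto simp: omega_language_def)
  define \<sigma> where "\<sigma> = label_word S s'"
  define lab where "lab n = label_word S (stake n r)" for n
  define m where "m = length s'"
  \<comment> \<open>The states of the run itself witness that the estimates along \<open>r\<close>
    are nonempty.\<close>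
  have mem: "x (m + n) \<in> state_estimate S (\<sigma> @ lab n)" for n
  proof -
    have "stake (m + n) s = s' @ stake n r"
      by (simp add: r m_def stake_shift)
    then have "steps S (x 0) (s' @ stake n r) (x (m + n))"
      using run_steps[OF x, of 0 "m + n"] by simp
    moreover have "label_word S (s' @ stake n r) = \<sigma> @ lab n"
      by (simp add: \<sigma>_def lab_def)
    ultimately show ?thesis
      using x0 unfolding state_estimate_iff by blast
  qed
  have r_events: "set (stake n r) \<subseteq> events S" for n
  proof -
    have "sset s \<subseteq> events S"
      using ev by (simp add: streams_iff_sset)
    moreover have "sset s = set s' \<union> set (stake n r) \<union> sset (sdrop n r)"
      by (metis r stake_sdrop sset_shift Un_assoc)
    ultimately show ?thesis
      by blast
  qed
  \<comment> \<open>The prefix \<open>u\<close> is arbitrary because it is cut by position in the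
    first case below and by labels in the second.\<close>
  have bad': "card (state_estimate S (\<sigma> @ label_word S u)) \<noteq> 1"
    if "stake n r = u @ v" "length (label_word S u) \<le> K" for n u v
  proof -
    have "r = (u @ v) @- sdrop n r"
      using that(1) stake_sdrop[of n r] by simp
    then have "s = (s' @ u) @- v @- sdrop n r"
      by (simp add: r)
    moreover have "u \<in> lists (events S)"
      using r_events[of n] that(1) by auto
    ultimately show ?thesis
      using bad[of u] that(2) by (auto simp: stream_prefix_def \<sigma>_def)
  qed
  show thesis
  proof (cases "\<forall>n. length (lab n) < K")
    case True
    \<comment> \<open>The bounded label counts attain a maximum at some \<open>N\<close>; an
      observable event of \<open>r\<close> at position \<open>N\<close> or later would exceed
      it.\<close>
    then obtain N where N: "\<And>n. length (lab n) \<le> length (lab N)"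
      using ex_has_greatest_nat[of "\<lambda>_. True" 0 "\<lambda>n. length (lab n)" K] by (metis less_imp_le)
    have "label S (s !! i) = None" if "i \<ge> m + N" for i
    proof -
      define n where "n = i - m"
      have n: "i = m + n" "n \<ge> N"
        using that by (auto simp: n_def)
      have "stake (Suc n) r = stake N r @ stake (Suc n - N) (sdrop N r)"
        using n(2) stake_add[of N r "Suc n - N"] by simp
      then have "label_word S (stake (Suc n - N) (sdrop N r)) = []"
        using N[of "Suc n"] unfolding lab_def by (metis add_le_same_cancel1 label_word_append
          le_zero_eq length_0_conv length_append)
      moreover have "r !! n = stake (Suc n - N) (sdrop N r) ! (n - N)"
        using n(2) by (simp add: sdrop_snth del: stake.simps)
      then have "r !! n \<in> set (stake (Suc n - N) (sdrop N r))"
        using n(2) by (metis Suc_diff_le length_stake lessI nth_mem)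
      ultimately have "label S (r !! n) = None"
        by (auto simp: label_word_eq_Nil_iff)
      then show ?thesis
        by (simp add: r n(1) m_def)
    qed
    then obtain i w where i: "i \<ge> m + N" "w \<in> lists (unobservable_events S) - {[]}"
      "steps S (x i) w (x i)"
      using unobservable_tail_cycle[OF x] by blast
    \<comment> \<open>Position \<open>i\<close> of \<open>s\<close> is position \<open>i - m\<close>
      of \<open>r\<close>.\<close>
    define q where "q = state_estimate S (\<sigma> @ lab (i - m))"
    have "x i \<in> q"
      using mem[of "i - m"] i(1) by (simp add: q_def)
    moreover from this have "reachable (observer S) q"
      unfolding q_def by (intro reachable_observerI) auto
    moreover have "card q > 1"
      using \<open>x i \<in> q\<close> bad'[of "i - m" "stake (i - m) r" "[]"] True
      unfolding q_def by (intro card_state_estimate_gt_1) (auto simp: lab_def less_imp_le)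
    ultimately show thesis
      using unobservable i by blast
  next
    case False
    then obtain n where n: "K \<le> length (lab n)"
      by (auto simp: not_less)
    have "card (state_estimate S (\<sigma> @ take i (lab n))) \<noteq> 1" if "i \<le> K" for i
    proof -
      \<comment> \<open>\<open>take i (lab n)\<close> need not be the label of
        \<open>stake i r\<close>, so a matching event prefix is found by splitting labels.\<close>
      have "label_word S (stake n r) = take i (lab n) @ drop i (lab n)"
        by (simp add: lab_def)
      then obtain u v where "stake n r = u @ v" "label_word S u = take i (lab n)"
        by (rule label_word_eq_appendE)
      then show ?thesis
        using bad'[of n u v] that n by simp
    qed
    moreover have "state_estimate S (\<sigma> @ lab n) \<noteq> {}"
      using mem by blast
    ultimately show thesis
      using observer_cycleI observer n unfolding K_def by metis
  qed
qed

end

theorem theorem4p4: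
  fixes S :: "('q, 'e, 'o) fsa"
  assumes "finite_state_automaton S"
  shows "\<not> strongly_periodically_detectable S \<longleftrightarrow>
    (\<exists>q x. reachable (observer S) q \<and> x \<in> q \<and> card q > 1 \<and>
       (\<exists>s\<^sub>1 \<in> lists (unobservable_events S). \<exists>s\<^sub>2 \<in> lists (unobservable_events S) - {[]}.
          \<exists>x' \<in> states S. steps S x s\<^sub>1 x' \<and> steps S x' s\<^sub>2 x')) \<or>
    (\<exists>qs w. reachable_cycle (observer S) qs w \<and> (\<forall>q \<in> set qs. card q \<noteq> 1))"
    (is "?L \<longleftrightarrow> ?unobservable \<or> ?observer")
proof -
  interpret finite_state_automaton S
    by (rule assms)
  show ?thesis
  proof
    assume ?L
    then show "?unobservable \<or> ?observer"
    proof (cases rule: not_detectable_cases)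
      case (unobservable q x w)
      \<comment> \<open>The loop already sits at \<open>x\<close>, so \<open>[]\<close> serves as
        \<open>s\<^sub>1\<close> and \<open>x\<close> as \<open>x'\<close>.\<close>
      then have "x \<in> states S" "steps S x [] x"
        using steps_states by (auto simp: steps_Nil)
      then show ?thesis
        using unobservable by blast
    qed blast
  next
    assume "?unobservable \<or> ?observer"
    then show ?L
      using unobservable_cycle_not_detectable observer_cycle_not_detectable by blast
  qed
qed

end
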